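(* Let $K\in\mathbb{R}^{m\times n}$ be strictly stabilizing for $(A,B)$, let $\bar X=\bar X(K)$ be the stationary state covariance, and let $x$ be the stationary state. Let $G\in\mathbb{R}^{n\times n}$ be positive definite, $d>0$, $\varepsilon_x\in(0,1)$, and let $X\in\mathbb{R}^{n\times n}$ be any symmetric matrix such that $X\succeq\bar X$. Then the joint chance constraint $$\mathbf{P}\bigl[x^{\top}G^{-1}x\le d\bigr]\ge1-\varepsilon_x$$ is satisfied (i) in the case of a WSS disturbance, if $X\preceq\dfrac{d\,\varepsilon_x}{n}\,G$; (ii) in the case of a NRM disturbance, if $X\preceq\dfrac{d}{\mathrm{chi}_n^{-1}(1-\varepsilon_x)}\,G$.
   Context: Consider the discrete-time linear system $x_{t+1}=Ax_t+Bu_t+w_t$ with $A\in\mathbb{R}^{n\times n}$, $B\in\mathbb{R}^{n\times m}$, $(A,B)$ stabilizable, fixed initial condition $x_0\in\mathbb{R}^n$, and state feedback $u_t=Kx_t$. The disturbances $\{w_t\}$ are a white noise process with zero mean and common finite covariance $W=\mathbf{E}[w_tw_t^{\top}]\succ0$. The case "WSS" (wide-sense stationary) means that only these first two moments are specified; the case "NRM" means that in addition all $w_t$ are identically normally distributed. $K$ is strictly stabilizing if all eigenvalues of $A+BK$ have modulus less than $1$; then $\bar X(K)\succ0$ denotes the unique solution of $\bar X-(A+BK)\bar X(A+BK)^{\top}-W=0$. The stationary state $x$ is a random variable in $\mathbb{R}^n$ with mean $0$ and covariance $\bar X(K)$; in the WSS case its distribution is otherwise unspecified (the result is asserted for every such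 distribution), and in the NRM case $x\sim\mathcal{N}(0,\bar X(K))$. $\mathrm{chi}_n:[0,\infty)\to[0,1]$ is the cumulative distribution function of the chi-squared distribution with $n$ degrees of freedom. $\succeq,\preceq$ denote the semidefinite ordering on symmetric matrices. *)

theory Defs
  imports "HOL-Probability.Probability"
begin

definition symmetric_matrix :: "real^'n^'n \<Rightarrow> bool" where
  "symmetric_matrix P \<longleftrightarrow> transpose P = P"

definition pos_def :: "real^'n^'n \<Rightarrow> bool" where
  "pos_def P \<longleftrightarrow> symmetric_matrix P \<and> (\<forall>v. v \<noteq> 0 \<longrightarrow> 0 < v \<bullet> (P *v v))"

definition pos_semidef :: "real^'n^'n \<Rightarrow> bool" where
  "pos_semidef P \<longleftrightarrow> symmetric_matrix P \<and> (\<forall>v. 0 \<le> v \<bullet> (P *v v))"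

definition loewner_le :: "real^'n^'n \<Rightarrow> real^'n^'n \<Rightarrow> bool"  (infix "\<preceq>\<^sub>L" 50) where
  "P \<preceq>\<^sub>L Q \<longleftrightarrow> pos_semidef (Q - P)"

definition is_eigenvalue :: "complex^'n^'n \<Rightarrow> complex \<Rightarrow> bool" where
  "is_eigenvalue P z \<longleftrightarrow> (\<exists>v. v \<noteq> 0 \<and> P *v v = z *s v)"

definition strictly_stabilizing :: "real^'n^'n \<Rightarrow> real^'m^'n \<Rightarrow> real^'n^'m \<Rightarrow> bool" where
  "strictly_stabilizing A B K \<longleftrightarrow>
     (\<forall>z. is_eigenvalue (map_matrix complex_of_real (A + B ** K)) z \<longrightarrow> cmod z < 1)"

definition stabilizable :: "real^'n^'n \<Rightarrow> real^'m^'n \<Rightarrow> bool" where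
  "stabilizable A B \<longleftrightarrow> (\<exists>K. strictly_stabilizing A B K)"

text \<open>The description below is proper whenever \<open>K\<close> is strictly stabilizing, because the
  discrete Lyapunov equation then has exactly one solution.\<close>

definition stationary_covariance ::
    "real^'n^'n \<Rightarrow> real^'m^'n \<Rightarrow> real^'n^'m \<Rightarrow> real^'n^'n \<Rightarrow> real^'n^'n" where
  "stationary_covariance A B K W =
     (THE X. X - (A + B ** K) ** X ** transpose (A + B ** K) - W = 0)"

definition outer_product :: "real^'n \<Rightarrow> real^'m \<Rightarrow> real^'m^'n" where
  "outer_product u v = (\<chi> i j. u $ i * v $ j)"

definition square_integrable :: "'a measure \<Rightarrow> ('a \<Rightarrow> real^'n) \<Rightarrow> bool" where
  "square_integrable M x \<longleftrightarrow> x \<in> borel_measurable M \<and> integrable M (\<lambda>\<omega>. (norm (x \<omega>))\<^sup>2)"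

definition mean :: "'a measure \<Rightarrow> ('a \<Rightarrow> real^'n) \<Rightarrow> real^'n" where
  "mean M x = (LINT \<omega>|M. x \<omega>)"

definition cross_covariance ::
    "'a measure \<Rightarrow> ('a \<Rightarrow> real^'n) \<Rightarrow> ('a \<Rightarrow> real^'n) \<Rightarrow> real^'n^'n" where
  "cross_covariance M x y = (LINT \<omega>|M. outer_product (x \<omega> - mean M x) (y \<omega> - mean M y))"

definition white_noise :: "'a measure \<Rightarrow> (nat \<Rightarrow> 'a \<Rightarrow> real^'n) \<Rightarrow> real^'n^'n \<Rightarrow> bool" where
  "white_noise M w W \<longleftrightarrow>
     (\<forall>t. square_integrable M (w t) \<and> mean M (w t) = 0 \<and> cross_covariance M (w t) (w t) = W) \<and>
     (\<forall>s t. s \<noteq> t \<longrightarrow> cross_covariance M (w s) (w t) = 0)"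

definition multivariate_normal_density :: "real^'n \<Rightarrow> real^'n^'n \<Rightarrow> real^'n \<Rightarrow> real" where
  "multivariate_normal_density \<mu> S y =
     exp (- ((y - \<mu>) \<bullet> (matrix_inv S *v (y - \<mu>))) / 2) / sqrt ((2 * pi) ^ CARD('n) * det S)"

text \<open>Only nondegenerate normal distributions are covered, so the covariance must be
  positive definite.\<close>

definition multivariate_normal ::
    "'a measure \<Rightarrow> ('a \<Rightarrow> real^'n) \<Rightarrow> real^'n \<Rightarrow> real^'n^'n \<Rightarrow> bool" where
  "multivariate_normal M x \<mu> S \<longleftrightarrow>
     pos_def S \<and> distributed M lborel x (\<lambda>y. ennreal (multivariate_normal_density \<mu> S y))"

definition stationary_state_wss :: "'a measure \<Rightarrow> ('a \<Rightarrow> real^'n) \<Rightarrow> real^'n^'n \<Rightarrow> bool" where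
  "stationary_state_wss M x S \<longleftrightarrow>
     square_integrable M x \<and> mean M x = 0 \<and> cross_covariance M x x = S"

definition stationary_state_nrm :: "'a measure \<Rightarrow> ('a \<Rightarrow> real^'n) \<Rightarrow> real^'n^'n \<Rightarrow> bool" where
  "stationary_state_nrm M x S \<longleftrightarrow> multivariate_normal M x 0 S"

text \<open>The chi-squared distribution is the law of the sum of squares of \<open>n\<close> independent
  standard normal variables.\<close>

definition chi_squared :: "nat \<Rightarrow> real measure" where
  "chi_squared n =
     distr (PiM {..<n} (\<lambda>_. std_normal_distribution)) borel (\<lambda>z. \<Sum>i<n. (z i)\<^sup>2)"

definition chi :: "nat \<Rightarrow> real \<Rightarrow> real" where
  "chi n = cdf (chi_squared n)"

text \<open>For \<open>n \<ge> 1\<close> the restriction of \<open>chi n\<close> to \<open>{0..}\<close> is strictly increasing with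
  range \<open>{0..<1}\<close>, and the inverse is meant on that range.\<close>

definition chi_inv :: "nat \<Rightarrow> real \<Rightarrow> real" where
  "chi_inv n = the_inv_into {0..} (chi n)"

definition joint_chance_constraint ::
    "'a measure \<Rightarrow> ('a \<Rightarrow> real^'n) \<Rightarrow> real^'n^'n \<Rightarrow> real \<Rightarrow> real \<Rightarrow> bool" where
  "joint_chance_constraint M x G d \<epsilon> \<longleftrightarrow>
     measure M {\<omega> \<in> space M. x \<omega> \<bullet> (matrix_inv G *v x \<omega>) \<le> d} \<ge> 1 - \<epsilon>"

end

theory Submission
  imports Defs
begin

text \<open>
  Write \<open>S\<close> for the stationary covariance, \<open>n\<close> for \<open>CARD('n)\<close> and \<open>c\<close> for the chi-squared quantile of
  \<open>1 - \<epsilon>\<close>. As \<open>S \<preceq>\<^sub>L X\<close>, each of the two bounds on \<open>X\<close> passes to \<open>S\<close>, the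
  covariance of the state.

  For a wide-sense stationary state the expected value of \<open>x \<bullet> G\<^bsup>-1\<^esup> x\<close> is the trace of \<open>G\<^bsup>-1\<^esup> S\<close>,
  which is at most \<open>d \<epsilon>\<close> if \<open>S \<preceq>\<^sub>L (d \<epsilon> / n) G\<close>; Markov's inequality then gives the claim
  (\<open>wss_joint_chance_constraint\<close>). The trace is evaluated along a basis that is orthonormal for the inner
  product of \<open>G\<close> (\<open>pos_def_whitening\<close>).

  For a normal state \<open>x \<bullet> S\<^bsup>-1\<^esup> x\<close> is chi-squared distributed with \<open>n\<close> degrees of freedom
  (\<open>multivariate_normal_mahalanobis_chi\<close>), so it is at most \<open>c\<close> with probability \<open>1 - \<epsilon>\<close>
  (\<open>chi_inv_properties\<close>). Inversion reverses the semidefinite ordering: \<open>S \<preceq>\<^sub>L (d / c) G\<close> gives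
  \<open>x \<bullet> G\<^bsup>-1\<^esup> x \<le> (d / c) (x \<bullet> S\<^bsup>-1\<^esup> x)\<close> (\<open>loewner_le_inverse_quadratic_form\<close>), so the first ellipsoid
  event is contained in the required one.

  The chi-squared law is obtained by the substitution \<open>z = R y\<close> with \<open>R S R\<^sup>T = 1\<close>. In place of the
  determinant formula for linear substitutions it suffices that integrals change by a common factor
  (\<open>nn_integral_linear_image_proportional\<close>), because the total mass 1 fixes that factor.
\<close>

section \<open>Positive definite matrices and the semidefinite ordering\<close>

lemma pos_def_invertible:
  assumes "pos_def P"
  shows "invertible P"
proof -
  have "\<forall>v. P *v v = 0 \<longrightarrow> v = 0"
    using assms unfolding pos_def_def by (metis inner_zero_right less_irrefl)
  then show ?thesis
    by (metis invertible_left_inverse matrix_left_invertible_ker)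
qed

lemma matrix_inv_left_right:
  fixes P :: "real^'n^'n"
  assumes "invertible P"
  shows "matrix_inv P ** P = mat 1" "P ** matrix_inv P = mat 1"
  using someI_ex[OF assms[unfolded invertible_def]] unfolding matrix_inv_def by auto

lemma matrix_inv_vector_cancel:
  fixes P :: "real^'n^'n"
  assumes "invertible P"
  shows "P *v (matrix_inv P *v x) = x"
  using matrix_inv_left_right(2)[OF assms] by (simp only: matrix_vector_mul_assoc matrix_vector_mul_lid)

lemma symmetric_matrix_inner_commute:
  fixes P :: "real^'n^'n"
  assumes "symmetric_matrix P"
  shows "u \<bullet> (P *v v) = v \<bullet> (P *v u)"
  using assms unfolding symmetric_matrix_def
  by (metis dot_lmul_matrix inner_commute vector_transpose_matrix)

lemma congruence_entry:
  fixes R P :: "real^'n^'n"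
  shows "(R ** P ** transpose R) $ i $ j = R $ i \<bullet> (P *v R $ j)"
proof -
  have "(R ** P ** transpose R) $ i $ j = (\<Sum>k\<in>UNIV. (\<Sum>l\<in>UNIV. R $ i $ l * P $ l $ k) * R $ j $ k)"
    by (simp add: matrix_matrix_mult_def transpose_def)
  also have "\<dots> = (\<Sum>l\<in>UNIV. R $ i $ l * (\<Sum>k\<in>UNIV. P $ l $ k * R $ j $ k))"
    unfolding sum_distrib_left sum_distrib_right by (subst sum.swap) (simp add: mult.assoc)
  finally show ?thesis
    by (simp add: inner_vec_def matrix_vector_mult_def)
qed

text \<open>Gram--Schmidt for the inner product \<open>\<langle>u, v\<rangle> = u \<bullet> (P *v v)\<close>: while fewer than \<open>CARD('n)\<close> vectors
  have been found, some vector lies outside their span, and its normalised component orthogonal to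
  them extends the family. The index set is kept arbitrary to allow induction over it.\<close>

lemma pos_def_orthonormal_family:
  fixes P :: "real^'n^'n"
  assumes P: "pos_def P"
  shows "\<exists>r :: 'n \<Rightarrow> real^'n. \<forall>i\<in>I. \<forall>j\<in>I. r i \<bullet> (P *v r j) = (if i = j then 1 else 0)"
  using finite[of I]
proof (induction I)
  case empty
  then show ?case by simp
next
  case (insert i I)
  then obtain r :: "'n \<Rightarrow> real^'n"
    where r: "\<And>j k. j \<in> I \<Longrightarrow> k \<in> I \<Longrightarrow> r j \<bullet> (P *v r k) = (if j = k then 1 else 0)"
    by blast
  have comm: "u \<bullet> (P *v v) = v \<bullet> (P *v u)" for u v
    using P symmetric_matrix_inner_commute unfolding pos_def_def by blast
  have "card (insert i I) \<le> CARD('n)"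
    by (rule card_mono) auto
  moreover have "dim (span (r ` I)) \<le> card I"
    using dim_le_card'[of "r ` I"] card_image_le[OF insert.hyps(1), of r] insert.hyps(1) by simp
  ultimately have "dim (span (r ` I)) < DIM(real^'n)"
    using insert.hyps by simp
  then have "span (r ` I) \<noteq> UNIV"
    using dim_UNIV[where 'a="real^'n"] by (intro notI) (simp only: less_irrefl)
  then obtain v where v: "v \<notin> span (r ` I)"
    by blast
  define u where "u = v - (\<Sum>k\<in>I. (r k \<bullet> (P *v v)) *\<^sub>R r k)"
  have "u \<noteq> 0"
  proof
    assume "u = 0"
    then have "v = (\<Sum>k\<in>I. (r k \<bullet> (P *v v)) *\<^sub>R r k)"
      by (simp add: u_def)
    also have "\<dots> \<in> span (r ` I)"
      by (intro span_sum span_scale span_base imageI)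
    finally show False using v by simp
  qed
  then have pos: "0 < u \<bullet> (P *v u)"
    using P unfolding pos_def_def by blast
  have orth: "r j \<bullet> (P *v u) = 0" if "j \<in> I" for j
  proof -
    have "r j \<bullet> (P *v u) = r j \<bullet> (P *v v) - (\<Sum>k\<in>I. (r k \<bullet> (P *v v)) * (r j \<bullet> (P *v r k)))"
      by (simp add: u_def matrix_vector_mult_diff_distrib linear_sum[OF matrix_vector_mul_linear]
          inner_diff_right inner_sum_right matrix_vector_mult_scaleR)
    also have "(\<Sum>k\<in>I. (r k \<bullet> (P *v v)) * (r j \<bullet> (P *v r k))) =
        (\<Sum>k\<in>I. if k = j then r k \<bullet> (P *v v) else 0)"
      using r[OF that] by (intro sum.cong) auto
    finally show ?thesis
      using that insert.hyps by simp
  qed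
  define q where "q = u /\<^sub>R sqrt (u \<bullet> (P *v u))"
  have qq: "q \<bullet> (P *v q) = 1"
    using pos real_sqrt_mult_self[of "u \<bullet> (P *v u)"]
    by (simp add: q_def matrix_vector_mult_scaleR divide_simps)
  have rq: "r j \<bullet> (P *v q) = 0" if "j \<in> I" for j
    using orth[OF that] by (simp add: q_def matrix_vector_mult_scaleR)
  have qr: "q \<bullet> (P *v r j) = 0" if "j \<in> I" for j
    using rq[OF that] comm[of q "r j"] by simp
  show ?case
  proof (intro exI[of _ "r(i := q)"] ballI)
    fix j k assume "j \<in> insert i I" "k \<in> insert i I"
    then show "(r(i := q)) j \<bullet> (P *v (r(i := q)) k) = (if j = k then 1 else 0)"
      using insert.hyps r qq rq qr by auto
  qed
qed

text \<open>An orthonormal basis for the inner product of \<open>P\<close>, written as the rows of \<open>R\<close>, turns \<open>P\<close> into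
  the identity. Inverting \<open>R P R\<^sup>T = 1\<close> gives \<open>P\<^bsup>-1\<^esup> = R\<^sup>T R\<close>, so the quadratic form of the inverse
  becomes a sum of squares of linear forms. This takes the place of a matrix square root.\<close>

lemma pos_def_whitening:
  fixes P :: "real^'n^'n"
  assumes P: "pos_def P"
  obtains R :: "real^'n^'n" where "R ** P ** transpose R = mat 1" "invertible R"
    "\<And>x. x \<bullet> (matrix_inv P *v x) = (norm (R *v x))\<^sup>2"
proof -
  obtain r :: "'n \<Rightarrow> real^'n"
    where r: "\<And>i j. r i \<bullet> (P *v r j) = (if i = j then 1 else 0)"
    using pos_def_orthonormal_family[OF P, of UNIV] by blast
  define R where "R = (\<chi> i. r i)"
  have RPR: "R ** P ** transpose R = mat 1"
    by (simp add: vec_eq_iff congruence_entry R_def r mat_def)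
  then have RP: "R ** (P ** transpose R) = mat 1"
    by (simp only: matrix_mul_assoc)
  have inv: "invertible R"
    unfolding invertible_right_inverse using RP by blast
  have PRR: "P ** (transpose R ** R) = mat 1"
    using RP[unfolded matrix_left_right_inverse[of R]] by (simp only: matrix_mul_assoc)
  have "matrix_inv P = matrix_inv P ** (P ** (transpose R ** R))"
    by (simp only: PRR matrix_mul_rid)
  also have "\<dots> = transpose R ** R"
    using matrix_inv_left_right(1)[OF pos_def_invertible[OF P]] by (simp only: matrix_mul_assoc matrix_mul_lid)
  finally have Pinv: "matrix_inv P = transpose R ** R" .
  have "x \<bullet> (matrix_inv P *v x) = (norm (R *v x))\<^sup>2" for x
  proof -
    have "x \<bullet> (matrix_inv P *v x) = x \<bullet> (transpose R *v (R *v x))"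
      by (simp only: Pinv matrix_vector_mul_assoc)
    also have "\<dots> = (x v* transpose R) \<bullet> (R *v x)"
      by (simp only: dot_lmul_matrix)
    finally show ?thesis
      by (simp add: power2_norm_eq_inner)
  qed
  with RPR inv show thesis by (rule that)
qed

lemma loewner_le_scaled_quadratic_form:
  fixes P G :: "real^'n^'n"
  assumes "P \<preceq>\<^sub>L c *\<^sub>R G"
  shows "v \<bullet> (P *v v) \<le> c * (v \<bullet> (G *v v))"
  using assms unfolding loewner_le_def pos_semidef_def
  by (simp add: matrix_vector_mult_diff_rdistrib scaleR_matrix_vector_assoc[symmetric] inner_diff_right)

lemma loewner_le_trans:
  assumes "P \<preceq>\<^sub>L Q" "Q \<preceq>\<^sub>L S"
  shows "P \<preceq>\<^sub>L S"
proof -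
  have add: "pos_semidef (C + D)" if "pos_semidef C" "pos_semidef D" for C D :: "real^'n^'n"
    using that by (simp add: pos_semidef_def symmetric_matrix_def transpose_def vec_eq_iff
        matrix_vector_mult_add_rdistrib inner_add_right)
  show ?thesis
    using add[OF assms(1)[unfolded loewner_le_def] assms(2)[unfolded loewner_le_def]]
    by (simp add: loewner_le_def)
qed

text \<open>Matrix inversion reverses the semidefinite ordering. With \<open>P y = x = G v\<close>, expanding
  \<open>0 \<le> (k y - v) \<bullet> P (k y - v)\<close> and bounding \<open>v \<bullet> P v\<close> by \<open>k (v \<bullet> G v) = k (v \<bullet> x)\<close> leaves
  \<open>0 \<le> k (k (y \<bullet> x) - v \<bullet> x)\<close>.\<close>

lemma loewner_le_inverse_quadratic_form:
  fixes P G :: "real^'n^'n"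
  assumes P: "pos_def P" and G: "pos_def G" and le: "P \<preceq>\<^sub>L k *\<^sub>R G" and k: "0 < k"
  shows "x \<bullet> (matrix_inv G *v x) \<le> k * (x \<bullet> (matrix_inv P *v x))"
proof -
  define v y where "v = matrix_inv G *v x" and "y = matrix_inv P *v x"
  have Gv: "G *v v = x" and Py: "P *v y = x"
    by (simp_all add: v_def y_def matrix_inv_vector_cancel pos_def_invertible P G)
  have Pvy: "y \<bullet> (P *v v) = v \<bullet> x"
    using P symmetric_matrix_inner_commute[of P y v] Py unfolding pos_def_def by simp
  have "0 \<le> (k *\<^sub>R y - v) \<bullet> (P *v (k *\<^sub>R y - v))"
    using P unfolding pos_def_def by (metis inner_zero_left less_eq_real_def)
  also have "\<dots> = k\<^sup>2 * (y \<bullet> x) - 2 * k * (v \<bullet> x) + v \<bullet> (P *v v)"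
    by (simp add: matrix_vector_mult_diff_distrib matrix_vector_mult_scaleR inner_diff_left
        inner_diff_right Py Pvy power2_eq_square algebra_simps)
  also have "v \<bullet> (P *v v) \<le> k * (v \<bullet> x)"
    using loewner_le_scaled_quadratic_form[OF le, of v] Gv by simp
  finally have "0 \<le> k * (k * (y \<bullet> x) - v \<bullet> x)"
    by (simp add: power2_eq_square algebra_simps)
  then show ?thesis
    using k by (simp add: zero_le_mult_iff v_def y_def inner_commute)
qed

section \<open>Wide-sense stationary states\<close>

lemma norm_le_sum_entries:
  fixes Q :: "real^'n^'m"
  shows "norm Q \<le> (\<Sum>i\<in>UNIV. \<Sum>j\<in>UNIV. \<bar>Q $ i $ j\<bar>)"
proof -
  have "norm Q \<le> (\<Sum>i\<in>UNIV. norm (Q $ i))"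
    unfolding norm_vec_def[of Q] by (rule L2_set_le_sum) simp
  also have "\<dots> \<le> (\<Sum>i\<in>UNIV. \<Sum>j\<in>UNIV. \<bar>Q $ i $ j\<bar>)"
    by (intro sum_mono norm_le_l1_cart)
  finally show ?thesis .
qed

lemma square_integrable_inner_power2:
  fixes x :: "'a \<Rightarrow> real^'n"
  assumes x: "square_integrable M x"
  shows "integrable M (\<lambda>\<omega>. (v \<bullet> x \<omega>)\<^sup>2)"
proof (rule Bochner_Integration.integrable_bound)
  show "integrable M (\<lambda>\<omega>. (norm v)\<^sup>2 * (norm (x \<omega>))\<^sup>2)"
    using x unfolding square_integrable_def by simp
  have [measurable]: "x \<in> borel_measurable M"
    using x unfolding square_integrable_def by simp
  show "(\<lambda>\<omega>. (v \<bullet> x \<omega>)\<^sup>2) \<in> borel_measurable M"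
    by measurable
  have "(v \<bullet> y)\<^sup>2 \<le> (norm v)\<^sup>2 * (norm y)\<^sup>2" for y
    by (metis Cauchy_Schwarz_ineq power2_norm_eq_inner)
  then show "AE \<omega> in M. norm ((v \<bullet> x \<omega>)\<^sup>2) \<le> norm ((norm v)\<^sup>2 * (norm (x \<omega>))\<^sup>2)"
    by simp
qed

lemma outer_product_quadratic_form:
  "v \<bullet> (outer_product u u *v v) = (v \<bullet> u)\<^sup>2"
proof -
  have "outer_product u u *v v = (v \<bullet> u) *\<^sub>R u"
    by (simp add: vec_eq_iff outer_product_def matrix_vector_mult_def inner_vec_def
        sum_distrib_left mult_ac)
  then show ?thesis
    by (simp add: power2_eq_square)
qed

text \<open>The quadratic form at \<open>v\<close> is a continuous linear functional of the matrix, so it commutes with the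
  matrix-valued integral; square integrability of the norm makes that integral exist.\<close>

lemma second_moment_eq_covariance_form:
  fixes x :: "'a \<Rightarrow> real^'n"
  assumes x: "square_integrable M x" and mean: "mean M x = 0"
  shows "(LINT \<omega>|M. (v \<bullet> x \<omega>)\<^sup>2) = v \<bullet> (cross_covariance M x x *v v)"
proof -
  have [measurable]: "x \<in> borel_measurable M"
    using x unfolding square_integrable_def by simp
  have norm_le: "norm (outer_product u u) \<le> real CARD('n) * real CARD('n) * (norm u)\<^sup>2" for u :: "real^'n"
  proof -
    have "norm (outer_product u u) \<le> (\<Sum>i\<in>UNIV. \<Sum>j\<in>UNIV. \<bar>outer_product u u $ i $ j\<bar>)"
      by (rule norm_le_sum_entries)
    also have "\<dots> \<le> (\<Sum>i\<in>(UNIV::'n set). \<Sum>j\<in>(UNIV::'n set). (norm u)\<^sup>2)"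
      by (intro sum_mono)
        (auto simp: outer_product_def abs_mult power2_eq_square intro!: mult_mono component_le_norm_cart)
    finally show ?thesis by simp
  qed
  have "(\<lambda>u :: real^'n. outer_product u u) \<in> borel_measurable borel"
    unfolding outer_product_def
    by (intro borel_measurable_continuous_onI continuous_on_vec_lambda continuous_intros)
  then have meas: "(\<lambda>\<omega>. outer_product (x \<omega>) (x \<omega>)) \<in> borel_measurable M"
    by measurable
  have "integrable M (\<lambda>\<omega>. outer_product (x \<omega>) (x \<omega>))"
  proof (rule Bochner_Integration.integrable_bound)
    show "integrable M (\<lambda>\<omega>. real CARD('n) * real CARD('n) * (norm (x \<omega>))\<^sup>2)"
      using x unfolding square_integrable_def by simp
    show "AE \<omega> in M. norm (outer_product (x \<omega>) (x \<omega>))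
        \<le> norm (real CARD('n) * real CARD('n) * (norm (x \<omega>))\<^sup>2)"
      using norm_le by simp
  qed (fact meas)
  moreover have "bounded_linear (\<lambda>Q :: real^'n^'n. v \<bullet> (Q *v v))"
    unfolding linear_conv_bounded_linear[symmetric]
    by (rule linearI) (simp_all add: matrix_vector_mult_add_rdistrib inner_add_right
        scaleR_matrix_vector_assoc[symmetric])
  ultimately have "(LINT \<omega>|M. v \<bullet> (outer_product (x \<omega>) (x \<omega>) *v v)) =
      v \<bullet> ((LINT \<omega>|M. outer_product (x \<omega>) (x \<omega>)) *v v)"
    by (intro integral_bounded_linear)
  then show ?thesis
    by (simp add: outer_product_quadratic_form cross_covariance_def mean)
qed

text \<open>Whitening \<open>G\<close> writes \<open>x \<bullet> G\<^bsup>-1\<^esup> x\<close> as the sum over the rows \<open>r\<close> of \<open>R\<close> of \<open>(r \<bullet> x)\<^sup>2\<close>. Each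
  summand has mean \<open>r \<bullet> S r \<le> (d \<epsilon> / n) (r \<bullet> G r) = d \<epsilon> / n\<close>, so the mean of the sum is at most
  \<open>d \<epsilon>\<close>, and Markov's inequality bounds the probability of exceeding \<open>d\<close> by \<open>\<epsilon>\<close>.\<close>

lemma wss_joint_chance_constraint:
  fixes x :: "'a \<Rightarrow> real^'n" and G :: "real^'n^'n"
  assumes M: "prob_space M" and G: "pos_def G" and d: "0 < d" 
    and x: "stationary_state_wss M x S" and le: "S \<preceq>\<^sub>L (d * \<epsilon> / real CARD('n)) *\<^sub>R G"
  shows "joint_chance_constraint M x G d \<epsilon>"
proof -
  interpret prob_space M by (fact M)
  have sq: "square_integrable M x" and mean: "mean M x = 0" and cov: "cross_covariance M x x = S"
    using x unfolding stationary_state_wss_def by auto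
  have [measurable]: "x \<in> borel_measurable M"
    using sq unfolding square_integrable_def by simp
  obtain R :: "real^'n^'n" where RGR: "R ** G ** transpose R = mat 1" and "invertible R"
    and inv: "\<And>x. x \<bullet> (matrix_inv G *v x) = (norm (R *v x))\<^sup>2"
    using pos_def_whitening[OF G] by metis
  define q where "q \<omega> = x \<omega> \<bullet> (matrix_inv G *v x \<omega>)" for \<omega>
  have q: "q \<omega> = (\<Sum>i\<in>UNIV. (R $ i \<bullet> x \<omega>)\<^sup>2)" for \<omega>
    unfolding q_def inv power2_norm_eq_inner
    unfolding inner_vec_def[of "R *v x \<omega>"] matrix_vector_mul_component
    by (simp add: power2_eq_square)
  have q_nonneg: "0 \<le> q \<omega>" for \<omega>
    by (simp add: q_def inv)
  have row: "R $ i \<bullet> (G *v R $ i) = 1" for i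
    using RGR by (simp add: congruence_entry[symmetric] mat_def)
  have int: "integrable M q"
    unfolding q using square_integrable_inner_power2[OF sq] by simp
  have "(LINT \<omega>|M. q \<omega>) = (\<Sum>i\<in>UNIV. R $ i \<bullet> (S *v R $ i))"
    unfolding q using square_integrable_inner_power2[OF sq]
    by (simp add: second_moment_eq_covariance_form[OF sq mean] cov)
  also have "\<dots> \<le> (\<Sum>i\<in>(UNIV :: 'n set). d * \<epsilon> / real CARD('n))"
    using loewner_le_scaled_quadratic_form[OF le] row by (intro sum_mono) (metis mult.right_neutral)
  finally have Eq: "(LINT \<omega>|M. q \<omega>) \<le> d * \<epsilon>" by simp
  have [measurable]: "q \<in> borel_measurable M"
    using int by simp
  have "prob {\<omega> \<in> space M. d < q \<omega>} \<le> prob {\<omega> \<in> space M. d \<le> q \<omega>}"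
    by (intro finite_measure_mono) auto
  also have "\<dots> \<le> (LINT \<omega>|M. q \<omega>) / d"
    by (rule integral_Markov_inequality_measure[where A="{}"]) (auto simp: int d q_nonneg)
  also have "\<dots> \<le> \<epsilon>"
    using Eq d by (simp add: field_simps)
  finally have "prob {\<omega> \<in> space M. d < q \<omega>} \<le> \<epsilon>" .
  moreover have "prob {\<omega> \<in> space M. \<not> (d < q \<omega>)} = 1 - prob {\<omega> \<in> space M. d < q \<omega>}"
    by (rule prob_neg) measurable
  ultimately show ?thesis
    by (simp add: joint_chance_constraint_def q_def not_less)
qed

section \<open>The standard Gaussian and the chi-squared distribution\<close>

definition std_gaussian_density :: "'a::euclidean_space \<Rightarrow> real" where
  "std_gaussian_density z = (\<Prod>b\<in>Basis. std_normal_density (z \<bullet> b))"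

lemma std_gaussian_density_eq_exp_norm:
  "std_gaussian_density (z :: 'a::euclidean_space) = exp (- (norm z)\<^sup>2 / 2) / sqrt (2 * pi) ^ DIM('a)"
proof -
  have "std_gaussian_density z = (\<Prod>b\<in>Basis. exp (- (z \<bullet> b)\<^sup>2 / 2)) / (\<Prod>b\<in>(Basis::'a set). sqrt (2 * pi))"
    by (simp add: std_gaussian_density_def normal_density_def prod_dividef)
  also have "(\<Prod>b\<in>Basis. exp (- (z \<bullet> b)\<^sup>2 / 2)) = exp (\<Sum>b\<in>Basis. - (z \<bullet> b)\<^sup>2 / 2)"
    by (simp add: exp_sum)
  also have "(\<Sum>b\<in>Basis. - (z \<bullet> b)\<^sup>2 / 2) = - (norm z)\<^sup>2 / 2"
    unfolding power2_norm_eq_inner euclidean_inner[of z z]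
    by (simp add: sum_negf sum_divide_distrib[symmetric] power2_eq_square)
  finally show ?thesis by simp
qed

lemma std_gaussian_density_pos: "0 < std_gaussian_density z"
  unfolding std_gaussian_density_def by (intro prod_pos normal_density_pos) simp

lemma borel_measurable_std_gaussian_density [measurable]:
  "std_gaussian_density \<in> borel_measurable borel"
  unfolding std_gaussian_density_def by measurable

abbreviation std_gaussian :: "'a::euclidean_space measure" where
  "std_gaussian \<equiv> density lborel std_gaussian_density"

lemma density_PiM_eq_PiM_density:
  fixes f :: "real \<Rightarrow> real"
  assumes [measurable]: "f \<in> borel_measurable borel" and I: "finite I"
    and nonneg: "\<And>x. 0 \<le> f x" and M: "prob_space (density lborel f)"
  shows "density (PiM I (\<lambda>_. lborel)) (\<lambda>z. \<Prod>i\<in>I. f (z i)) = PiM I (\<lambda>_. density lborel f)"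
proof -
  interpret M: prob_space "density lborel f" by fact
  interpret product_sigma_finite "\<lambda>_. density lborel f"
    by standard
  interpret L: product_sigma_finite "\<lambda>_. lborel :: real measure"
    by standard
  show ?thesis
  proof (rule PiM_eqI[OF I])
    show "sets (density (PiM I (\<lambda>_. lborel)) (\<lambda>z. ennreal (\<Prod>i\<in>I. f (z i)))) =
        sets (PiM I (\<lambda>_. density lborel f))"
      by (simp cong: sets_PiM_cong)
    fix A assume A: "i \<in> I \<Longrightarrow> A i \<in> sets (density lborel f)" for i
    have [measurable]: "i \<in> I \<Longrightarrow> A i \<in> sets borel" for i using A by simp
    have "Pi\<^sub>E I A \<in> sets (PiM I (\<lambda>_. lborel))"
      using I by (intro sets_PiM_I_finite) auto
    then have "emeasure (density (PiM I (\<lambda>_. lborel)) (\<lambda>z. \<Prod>i\<in>I. f (z i))) (Pi\<^sub>E I A) =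
        (\<integral>\<^sup>+z. ennreal (\<Prod>i\<in>I. f (z i)) * indicator (Pi\<^sub>E I A) z \<partial>PiM I (\<lambda>_. lborel))"
      by (subst emeasure_density) auto
    also have "\<dots> = (\<integral>\<^sup>+z. (\<Prod>i\<in>I. ennreal (f (z i)) * indicator (A i) (z i)) \<partial>PiM I (\<lambda>_. lborel))"
    proof (rule nn_integral_cong)
      fix z assume "z \<in> space (PiM I (\<lambda>_. lborel :: real measure))"
      then have z: "z \<in> extensional I" by (simp add: space_PiM PiE_def)
      have "indicator (Pi\<^sub>E I A) z = (\<Prod>i\<in>I. indicator (A i) (z i) :: ennreal)"
      proof (cases "z \<in> Pi\<^sub>E I A")
        case True
        then have "(\<Prod>i\<in>I. indicator (A i) (z i) :: ennreal) = 1"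
          by (intro prod.neutral) (auto simp: PiE_def Pi_def)
        then show ?thesis using True by simp
      next
        case False
        then obtain i where "i \<in> I" "z i \<notin> A i"
          using z by (auto simp: PiE_def)
        then have "(\<Prod>i\<in>I. indicator (A i) (z i) :: ennreal) = 0"
          using I by (intro prod_zero bexI[of _ i]) auto
        then show ?thesis using False by simp
      qed
      then show "ennreal (\<Prod>i\<in>I. f (z i)) * indicator (Pi\<^sub>E I A) z =
          (\<Prod>i\<in>I. ennreal (f (z i)) * indicator (A i) (z i))"
        by (simp add: prod.distrib prod_ennreal nonneg)
    qed
    also have "\<dots> = (\<Prod>i\<in>I. \<integral>\<^sup>+t. ennreal (f t) * indicator (A i) t \<partial>lborel)"
      using I by (intro L.product_nn_integral_prod) auto
    also have "\<dots> = (\<Prod>i\<in>I. emeasure (density lborel f) (A i))"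
      by (intro prod.cong refl emeasure_density[symmetric]) auto
    finally show "emeasure (density (PiM I (\<lambda>_. lborel)) (\<lambda>z. \<Prod>i\<in>I. f (z i))) (Pi\<^sub>E I A) =
        (\<Prod>i\<in>I. emeasure (density lborel f) (A i))" .
  qed
qed

lemma prob_space_std_normal_distribution: "prob_space std_normal_distribution"
  using real_dist_normal_dist by (simp add: real_distribution_def)

lemma std_gaussian_eq_distr_PiM:
  "(std_gaussian :: 'a::euclidean_space measure) =
    distr (PiM Basis (\<lambda>_. std_normal_distribution)) borel (\<lambda>z. \<Sum>b\<in>Basis. z b *\<^sub>R b)"
proof -
  have [measurable]: "(\<lambda>z. \<Sum>b\<in>(Basis::'a set). z b *\<^sub>R b) \<in> PiM Basis (\<lambda>_. lborel) \<rightarrow>\<^sub>M borel"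
    by measurable
  have "(std_gaussian :: 'a measure) = density (distr (PiM Basis (\<lambda>_. lborel)) borel (\<lambda>z. \<Sum>b\<in>Basis. z b *\<^sub>R b))
      std_gaussian_density"
    by (simp add: lborel_eq[symmetric])
  also have "\<dots> = distr (density (PiM Basis (\<lambda>_. lborel))
      (\<lambda>z. ennreal (std_gaussian_density (\<Sum>b\<in>(Basis::'a set). z b *\<^sub>R b)))) borel (\<lambda>z. \<Sum>b\<in>Basis. z b *\<^sub>R b)"
    by (rule density_distr) measurable
  also have "(\<lambda>z. ennreal (std_gaussian_density (\<Sum>b\<in>(Basis::'a set). z b *\<^sub>R b))) =
      (\<lambda>z. ennreal (\<Prod>b\<in>Basis. std_normal_density (z b)))"
    by (auto simp: std_gaussian_density_def intro!: ext arg_cong[where f=ennreal] prod.cong)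
  also have "density (PiM (Basis::'a set) (\<lambda>_. lborel)) \<dots> = PiM Basis (\<lambda>_. std_normal_distribution)"
    by (rule density_PiM_eq_PiM_density) (auto simp: prob_space_std_normal_distribution)
  finally show ?thesis .
qed

lemma prob_space_std_gaussian: "prob_space (std_gaussian :: 'a::euclidean_space measure)"
  unfolding std_gaussian_eq_distr_PiM
  by (rule prob_space.prob_space_distr)
    (auto intro!: prob_space_PiM prob_space_std_normal_distribution)

text \<open>The chi-squared distribution is defined through a product measure indexed by numbers, the Gaussian
  on a Euclidean space through one indexed by basis vectors; a bijection between the two index sets
  identifies the sums of squares.\<close>

lemma chi_squared_eq_distr_std_gaussian:
  "chi_squared DIM('a) = distr (std_gaussian :: 'a::euclidean_space measure) borel (\<lambda>z. (norm z)\<^sup>2)"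
proof -
  let ?N = "std_normal_distribution"
  obtain e :: "nat \<Rightarrow> 'a" where e: "bij_betw e {..<DIM('a)} Basis"
    using ex_bij_betw_nat_finite[OF finite_Basis] by (auto simp: atLeast0LessThan)
  have reindex: "distr (PiM Basis (\<lambda>_. ?N)) (PiM {..<DIM('a)} (\<lambda>_. ?N)) (\<lambda>z. \<lambda>i\<in>{..<DIM('a)}. z (e i)) =
      PiM {..<DIM('a)} (\<lambda>_. ?N)"
    using e by (intro distr_PiM_reindex) (auto simp: prob_space_std_normal_distribution bij_betw_def)
  have eB: "i < DIM('a) \<Longrightarrow> e i \<in> Basis" for i
    using e by (auto simp: bij_betw_def)
  have [measurable]: "(\<lambda>z. \<lambda>i\<in>{..<DIM('a)}. z (e i)) \<in> PiM Basis (\<lambda>_. ?N) \<rightarrow>\<^sub>M PiM {..<DIM('a)} (\<lambda>_. ?N)"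
    using eB by (intro measurable_restrict measurable_component_singleton) auto
  have [measurable]: "(\<lambda>z. \<Sum>i<DIM('a). (z i)\<^sup>2) \<in> PiM {..<DIM('a)} (\<lambda>_. ?N) \<rightarrow>\<^sub>M borel"
    by measurable
  have "chi_squared DIM('a) = distr (PiM Basis (\<lambda>_. ?N)) borel
      ((\<lambda>z. \<Sum>i<DIM('a). (z i)\<^sup>2) \<circ> (\<lambda>z. \<lambda>i\<in>{..<DIM('a)}. z (e i)))"
    unfolding chi_squared_def by (subst reindex[symmetric], subst distr_distr) auto
  also have "(\<lambda>z. \<Sum>i<DIM('a). (z i)\<^sup>2) \<circ> (\<lambda>z. \<lambda>i\<in>{..<DIM('a)}. z (e i)) =
      (\<lambda>w. (norm w)\<^sup>2) \<circ> (\<lambda>z. \<Sum>b\<in>Basis. z b *\<^sub>R b)"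
  proof
    fix z :: "'a \<Rightarrow> real"
    have "(\<Sum>i<DIM('a). (z (e i))\<^sup>2) = (\<Sum>b\<in>Basis. (z b)\<^sup>2)"
      by (rule sum.reindex_bij_betw[OF e])
    also have "\<dots> = (norm (\<Sum>b\<in>Basis. z b *\<^sub>R b))\<^sup>2"
      unfolding power2_norm_eq_inner
      by (subst euclidean_inner) (simp add: power2_eq_square)
    finally show "((\<lambda>z. \<Sum>i<DIM('a). (z i)\<^sup>2) \<circ> (\<lambda>z. \<lambda>i\<in>{..<DIM('a)}. z (e i))) z =
      ((\<lambda>w. (norm w)\<^sup>2) \<circ> (\<lambda>z. \<Sum>b\<in>Basis. z b *\<^sub>R b)) z"
      by simp
  qed
  also have "distr (PiM Basis (\<lambda>_. ?N)) borel ((\<lambda>w. (norm w)\<^sup>2) \<circ> (\<lambda>z. \<Sum>b\<in>(Basis::'a set). z b *\<^sub>R b)) =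
      distr (std_gaussian :: 'a measure) borel (\<lambda>z. (norm z)\<^sup>2)"
    unfolding std_gaussian_eq_distr_PiM by (rule distr_distr[symmetric]) measurable
  finally show ?thesis .
qed

lemma chi_eq_std_gaussian:
  "chi DIM('a) c = measure (std_gaussian :: 'a::euclidean_space measure) {z. (norm z)\<^sup>2 \<le> c}"
  unfolding chi_def cdf_def chi_squared_eq_distr_std_gaussian
  by (subst measure_distr) (auto simp: vimage_def)

section \<open>Lebesgue measure under linear maps\<close>

lemma nn_integral_lborel_translate:
  fixes a :: "'a::euclidean_space"
  assumes [measurable]: "f \<in> borel_measurable borel"
  shows "(\<integral>\<^sup>+x. f (a + x) \<partial>lborel) = (\<integral>\<^sup>+x. f x \<partial>lborel)"
  by (subst (2) lborel_distr_plus[of a, symmetric]) (simp add: nn_integral_distr)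

lemma nn_integral_lborel_reflect:
  fixes f :: "'a::euclidean_space \<Rightarrow> ennreal"
  assumes [measurable]: "f \<in> borel_measurable borel"
  shows "(\<integral>\<^sup>+x. f (a - x) \<partial>lborel) = (\<integral>\<^sup>+x. f x \<partial>lborel)"
  by (subst (2) lborel_affine[of "-1" a]) (simp_all add: nn_integral_distr density_1)

text \<open>A surjective linear map pushes Lebesgue measure forward to a translation invariant measure, and two
  such measures are proportional. The equation states this with the unknown factor eliminated, so no
  determinant occurs and infinite integrals need no separate treatment. It is proved as the uniqueness
  of Haar measure: in the double integral of \<open>f x * g (h y - x)\<close> the inner integral over \<open>y\<close> does not
  depend on \<open>x\<close>, and reflecting \<open>x\<close> about \<open>h y\<close> exchanges the roles of \<open>f\<close> and \<open>g\<close>.\<close>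

lemma nn_integral_linear_image_proportional:
  fixes h :: "'a::euclidean_space \<Rightarrow> 'b::euclidean_space"
  assumes h: "linear h" "surj h"
    and [measurable]: "f \<in> borel_measurable borel" "g \<in> borel_measurable borel"
  shows "(\<integral>\<^sup>+x. f x \<partial>lborel) * (\<integral>\<^sup>+y. g (h y) \<partial>lborel) =
    (\<integral>\<^sup>+x. g x \<partial>lborel) * (\<integral>\<^sup>+y. f (h y) \<partial>lborel)"
proof -
  have [measurable]: "h \<in> borel_measurable borel"
    using h(1) by (intro borel_measurable_continuous_onI linear_continuous_on)
      (simp add: linear_conv_bounded_linear)
  have shift: "(\<integral>\<^sup>+y. k (h y - x) \<partial>lborel) = (\<integral>\<^sup>+y. k (h y) \<partial>lborel)"
    if [measurable]: "k \<in> borel_measurable borel" for k :: "'b \<Rightarrow> ennreal" and x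
  proof -
    obtain a where a: "h a = - x" using h(2) by (metis surjD)
    have "(\<integral>\<^sup>+y. k (h y - x) \<partial>lborel) = (\<integral>\<^sup>+y. k (h (a + y)) \<partial>lborel)"
      by (simp add: linear_add[OF h(1)] a)
    also have "\<dots> = (\<integral>\<^sup>+y. k (h y) \<partial>lborel)"
      by (rule nn_integral_lborel_translate) measurable
    finally show ?thesis .
  qed
  have "(\<integral>\<^sup>+x. f x \<partial>lborel) * (\<integral>\<^sup>+y. g (h y) \<partial>lborel) = (\<integral>\<^sup>+x. \<integral>\<^sup>+y. f x * g (h y - x) \<partial>lborel \<partial>lborel)"
    by (simp add: nn_integral_cmult shift nn_integral_multc)
  also have "\<dots> = (\<integral>\<^sup>+y. \<integral>\<^sup>+x. f x * g (h y - x) \<partial>lborel \<partial>lborel)"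
    by (rule pair_sigma_finite.Fubini'[symmetric]) (auto simp: pair_sigma_finite_def sigma_finite_lborel)
  also have "\<dots> = (\<integral>\<^sup>+y. \<integral>\<^sup>+x. f (h y - x) * g x \<partial>lborel \<partial>lborel)"
  proof (rule nn_integral_cong)
    fix y
    show "(\<integral>\<^sup>+x. f x * g (h y - x) \<partial>lborel) = (\<integral>\<^sup>+x. f (h y - x) * g x \<partial>lborel)"
      using nn_integral_lborel_reflect[of "\<lambda>x. f x * g (h y - x)" "h y"] by simp
  qed
  also have "\<dots> = (\<integral>\<^sup>+x. \<integral>\<^sup>+y. f (h y - x) * g x \<partial>lborel \<partial>lborel)"
    by (rule pair_sigma_finite.Fubini') (auto simp: pair_sigma_finite_def sigma_finite_lborel)
  also have "\<dots> = (\<integral>\<^sup>+x. g x \<partial>lborel) * (\<integral>\<^sup>+y. f (h y) \<partial>lborel)"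
    by (simp add: nn_integral_multc nn_integral_cmult shift mult.commute)
  finally show ?thesis .
qed

section \<open>The chi-squared quantile\<close>

lemma real_distribution_chi_squared: "real_distribution (chi_squared n)"
  unfolding chi_squared_def real_distribution_def real_distribution_axioms_def
  by (auto intro!: prob_space.prob_space_distr prob_space_PiM prob_space_std_normal_distribution)

lemma measure_std_gaussian_eq_0:
  fixes S :: "'a::euclidean_space set"
  assumes "negligible S" "S \<in> sets borel"
  shows "measure (std_gaussian :: 'a measure) S = 0"
proof -
  have "S \<in> null_sets lborel"
    using assms by (auto simp: negligible_iff_null_sets null_sets_def)
  then have "AE z in lborel. z \<notin> S" by (rule AE_not_in)
  then have "S \<in> null_sets (std_gaussian :: 'a measure)"
    using assms(2) by (subst null_sets_density_iff) auto
  then show ?thesis by (simp add: measure_def null_sets_def)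
qed

lemma measure_std_gaussian_open_pos:
  fixes S :: "'a::euclidean_space set"
  assumes "open S" "S \<noteq> {}"
  shows "0 < measure (std_gaussian :: 'a measure) S"
proof -
  interpret prob_space "std_gaussian :: 'a measure" by (rule prob_space_std_gaussian)
  have "S \<notin> null_sets (std_gaussian :: 'a measure)"
  proof
    assume "S \<in> null_sets (std_gaussian :: 'a measure)"
    then have "AE z in lborel. z \<notin> S"
      by (subst (asm) null_sets_density_iff) (auto simp: ennreal_eq_0_iff not_le[THEN iffD2, OF std_gaussian_density_pos])
    then have "negligible S"
      using assms(1) by (simp add: negligible_iff_null_sets AE_iff_null_sets[symmetric] null_sets_completionI)
    then show False
      using assms open_not_negligible by blast
  qed
  then have "measure (std_gaussian :: 'a measure) S \<noteq> 0"
    using assms(1) by (simp add: null_sets_def emeasure_eq_measure)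
  then show ?thesis
    by (simp add: less_le)
qed

text \<open>The squared norm has no atoms under the Gaussian, because spheres are Lebesgue null sets.\<close>

lemma continuous_chi: "continuous_on UNIV (chi DIM('a::euclidean_space))"
proof -
  interpret real_distribution "chi_squared DIM('a)" by (rule real_distribution_chi_squared)
  have "isCont (chi DIM('a)) c" for c
  proof -
    have "measure (chi_squared DIM('a)) {c} = measure (std_gaussian :: 'a measure) {z. (norm z)\<^sup>2 = c}"
      unfolding chi_squared_eq_distr_std_gaussian by (subst measure_distr) (auto simp: vimage_def)
    also have "\<dots> = 0"
    proof (rule measure_std_gaussian_eq_0)
      have "{z :: 'a. (norm z)\<^sup>2 = c} \<subseteq> sphere 0 (sqrt c)"
        by (auto simp: real_sqrt_unique)
      then show "negligible {z :: 'a. (norm z)\<^sup>2 = c}"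
        using negligible_sphere negligible_subset by blast
      show "{z :: 'a. (norm z)\<^sup>2 = c} \<in> sets borel"
        by measurable
    qed
    finally show ?thesis
      unfolding chi_def isCont_cdf .
  qed
  then show ?thesis
    by (simp add: continuous_at_imp_continuous_on)
qed

lemma chi_0: "chi DIM('a::euclidean_space) 0 = 0"
proof -
  have "{z :: 'a. (norm z)\<^sup>2 \<le> 0} = {0}" by auto
  then show ?thesis
    unfolding chi_eq_std_gaussian[where 'a='a] by (simp add: measure_std_gaussian_eq_0)
qed

text \<open>Between two radii lies a nonempty open shell, which the Gaussian charges.\<close>

lemma chi_strict_mono: "strict_mono_on {0..} (chi DIM('a::euclidean_space))"
proof (rule strict_mono_onI)
  fix a b :: real assume a: "a \<in> {0..}" and ab: "a < b"
  interpret prob_space "std_gaussian :: 'a measure" by (rule prob_space_std_gaussian)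
  let ?U = "{z :: 'a. a < (norm z)\<^sup>2 \<and> (norm z)\<^sup>2 < b}"
  let ?A = "{z :: 'a. (norm z)\<^sup>2 \<le> a}" and ?B = "{z :: 'a. (norm z)\<^sup>2 \<le> b}"
  have "open ?U"
    by (intro open_Collect_conj open_Collect_less continuous_intros)
  moreover obtain e :: 'a where "e \<in> Basis" using nonempty_Basis by blast
  then have "(norm (sqrt ((a + b) / 2) *\<^sub>R e))\<^sup>2 = (a + b) / 2"
    using a ab by (simp add: power_mult_distrib)
  then have "sqrt ((a + b) / 2) *\<^sub>R e \<in> ?U"
    using ab by simp
  then have "?U \<noteq> {}" by blast
  ultimately have "0 < prob ?U"
    by (rule measure_std_gaussian_open_pos)
  also have "prob ?U \<le> prob (?B - ?A)"
    by (intro finite_measure_mono) auto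
  also have "\<dots> = prob ?B - prob ?A"
    using ab by (intro finite_measure_Diff) auto
  finally show "chi DIM('a) a < chi DIM('a) b"
    by (simp add: chi_eq_std_gaussian[where 'a='a])
qed

text \<open>The inverse is defined by a description that is meaningful only on the range of an injective
  function; the intermediate value theorem shows that every \<open>p\<close> strictly between 0 and 1 is in that
  range.\<close>

lemma chi_inv_properties:
  assumes "0 < p" "p < 1"
  shows "0 < chi_inv DIM('a::euclidean_space) p" "chi DIM('a) (chi_inv DIM('a) p) = p"
proof -
  interpret real_distribution "chi_squared DIM('a)" by (rule real_distribution_chi_squared)
  have "(chi DIM('a) \<longlongrightarrow> 1) at_top"
    unfolding chi_def by (rule cdf_lim_at_top_prob)
  then have "eventually (\<lambda>b. p < chi DIM('a) b \<and> 0 \<le> b) at_top"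
    using assms(2) by (intro eventually_conj order_tendstoD(1) eventually_ge_at_top)
  then obtain b where b: "p < chi DIM('a) b" "0 \<le> b"
    using eventually_happens'[of at_top] by force
  then obtain c where c: "0 \<le> c" "chi DIM('a) c = p"
    using IVT'[of "chi DIM('a)" 0 p b] chi_0[where 'a='a] assms(1)
      continuous_on_subset[OF continuous_chi[where 'a='a]] by auto
  have "c \<noteq> 0"
    using c chi_0[where 'a='a] assms(1) by auto
  moreover have "chi_inv DIM('a) p = c"
    unfolding chi_inv_def using strict_mono_on_imp_inj_on[OF chi_strict_mono[where 'a='a]] c
    by (intro the_inv_into_f_eq) auto
  ultimately show "0 < chi_inv DIM('a) p" "chi DIM('a) (chi_inv DIM('a) p) = p"
    using c by auto
qed

section \<open>Normal states\<close>

lemma multivariate_normal_density_whitened: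
  fixes S R :: "real^'n^'n"
  assumes "\<And>y. y \<bullet> (matrix_inv S *v y) = (norm (R *v y))\<^sup>2"
  shows "multivariate_normal_density 0 S y =
    sqrt (2 * pi) ^ CARD('n) / sqrt ((2 * pi) ^ CARD('n) * det S) * std_gaussian_density (R *v y)"
  by (simp add: multivariate_normal_density_def std_gaussian_density_eq_exp_norm assms)

text \<open>Whitening the covariance turns
  the normal density into a multiple of the standard Gaussian density composed with \<open>R\<close>. The
  normalising constant is never computed: the total probability 1 and the probability of the
  ellipsoid are the same multiple of two integrals, whose ratio is known by proportionality of the
  pushed forward Lebesgue measure.\<close>

lemma multivariate_normal_mahalanobis_chi:
  fixes x :: "'a \<Rightarrow> real^'n"
  assumes M: "prob_space M" and x: "multivariate_normal M x 0 S"
  shows "measure M {\<omega> \<in> space M. x \<omega> \<bullet> (matrix_inv S *v x \<omega>) \<le> c} = chi CARD('n) c"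
proof -
  interpret prob_space M by (fact M)
  have S: "pos_def S"
    and dist: "distributed M lborel x (\<lambda>y. ennreal (multivariate_normal_density 0 S y))"
    using x unfolding multivariate_normal_def by auto
  obtain R :: "real^'n^'n" where "R ** S ** transpose R = mat 1" and R: "invertible R"
    and inv: "\<And>y. y \<bullet> (matrix_inv S *v y) = (norm (R *v y))\<^sup>2"
    using pos_def_whitening[OF S] by metis
  have lin: "linear ((*v) R)"
    by (rule matrix_vector_mul_linear)
  have surj: "surj ((*v) R)"
    using R by (simp only: invertible_right_inverse matrix_right_invertible_surjective)
  have [measurable]: "(*v) R \<in> borel_measurable borel"
    using lin by (intro borel_measurable_continuous_onI linear_continuous_on)
      (simp add: linear_conv_bounded_linear)
  have [measurable]: "x \<in> borel_measurable M"
    using distributed_measurable[OF dist] by simp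
  let ?g = "\<lambda>z :: real^'n. ennreal (std_gaussian_density z)"
  let ?B = "{z :: real^'n. (norm z)\<^sup>2 \<le> c}"
  let ?gB = "\<lambda>z :: real^'n. ?g z * indicator ?B z"
  define k where "k = ennreal (sqrt (2 * pi) ^ CARD('n) / sqrt ((2 * pi) ^ CARD('n) * det S))"
  have law: "emeasure M (x -` A \<inter> space M) = k * (\<integral>\<^sup>+y. ?g (R *v y) * indicator A y \<partial>lborel)"
    if A [measurable]: "A \<in> sets borel" for A
  proof -
    have "emeasure M (x -` A \<inter> space M) =
        (\<integral>\<^sup>+y. ennreal (multivariate_normal_density 0 S y) * indicator A y \<partial>lborel)"
      using distributed_emeasure[OF dist] A by simp
    \<comment> \<open>The embedding into the extended reals respects a product of reals whose second factor is
      nonnegative, whatever the sign of the first.\<close>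
    also have "\<dots> = (\<integral>\<^sup>+y. k * (?g (R *v y) * indicator A y) \<partial>lborel)"
      by (intro nn_integral_cong)
        (simp only: multivariate_normal_density_whitened[OF inv] k_def mult.assoc
          ennreal_mult''[OF less_imp_le[OF std_gaussian_density_pos]])
    also have "\<dots> = k * (\<integral>\<^sup>+y. ?g (R *v y) * indicator A y \<partial>lborel)"
      by (rule nn_integral_cmult) measurable
    finally show ?thesis .
  qed
  have total: "k * (\<integral>\<^sup>+y. ?g (R *v y) \<partial>lborel) = 1"
    using law[of UNIV] by (simp add: emeasure_space_1)
  have mass: "(\<integral>\<^sup>+z. ?g z \<partial>lborel) = 1"
    using prob_space.emeasure_space_1[OF prob_space_std_gaussian[where 'a="real^'n"]]
    by (simp add: emeasure_density)
  have ball: "x -` ((*v) R -` ?B) \<inter> space M = {\<omega> \<in> space M. x \<omega> \<bullet> (matrix_inv S *v x \<omega>) \<le> c}"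
    by (auto simp: inv)
  have "(*v) R -` ?B \<in> sets borel"
    by (rule measurable_sets_borel[of _ borel]) measurable
  \<comment> \<open>The Gaussian integral has value 1 and is inserted to match the proportionality lemma.\<close>
  from law[OF this]
  have "emeasure M {\<omega> \<in> space M. x \<omega> \<bullet> (matrix_inv S *v x \<omega>) \<le> c} =
      k * ((\<integral>\<^sup>+z. ?g z \<partial>lborel) * (\<integral>\<^sup>+y. ?gB (R *v y) \<partial>lborel))"
    unfolding ball mass by (simp add: indicator_def)
  also have "(\<integral>\<^sup>+z. ?g z \<partial>lborel) * (\<integral>\<^sup>+y. ?gB (R *v y) \<partial>lborel) =
      (\<integral>\<^sup>+z. ?gB z \<partial>lborel) * (\<integral>\<^sup>+y. ?g (R *v y) \<partial>lborel)"
    by (rule nn_integral_linear_image_proportional[OF lin surj]) measurable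
  also have "k * \<dots> = (\<integral>\<^sup>+z. ?gB z \<partial>lborel)"
    by (simp only: mult.left_commute[of k] total mult_1_right)
  also have "\<dots> = emeasure (std_gaussian :: (real^'n) measure) ?B"
    by (subst emeasure_density) auto
  finally show ?thesis
    using chi_eq_std_gaussian[where 'a="real^'n"] by (simp add: measure_def)
qed

text \<open>Since \<open>S\<close> is at most \<open>(d / c) G\<close> with \<open>c\<close> the chi-squared quantile of \<open>1 - \<epsilon>\<close>, the ellipsoid
  \<open>y \<bullet> S\<^bsup>-1\<^esup> y \<le> c\<close>, which has probability exactly \<open>1 - \<epsilon>\<close>, is contained in the ellipsoid
  \<open>y \<bullet> G\<^bsup>-1\<^esup> y \<le> d\<close>.\<close>

lemma nrm_joint_chance_constraint:
  fixes x :: "'a \<Rightarrow> real^'n" and G :: "real^'n^'n"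
  assumes M: "prob_space M" and G: "pos_def G" and d: "0 < d" and \<epsilon>: "0 < \<epsilon>" "\<epsilon> < 1"
    and x: "stationary_state_nrm M x S" and le: "S \<preceq>\<^sub>L (d / chi_inv CARD('n) (1 - \<epsilon>)) *\<^sub>R G"
  shows "joint_chance_constraint M x G d \<epsilon>"
proof -
  interpret prob_space M by (fact M)
  define c where "c = chi_inv CARD('n) (1 - \<epsilon>)"
  have c: "0 < c" "chi CARD('n) c = 1 - \<epsilon>"
    using chi_inv_properties[where 'a="real^'n", of "1 - \<epsilon>"] \<epsilon> by (simp_all add: c_def)
  have N: "multivariate_normal M x 0 S"
    using x unfolding stationary_state_nrm_def .
  then have S: "pos_def S"
    unfolding multivariate_normal_def by simp
  have [measurable]: "x \<in> borel_measurable M"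
    using N distributed_measurable[of M lborel x] unfolding multivariate_normal_def by auto
  have meas: "(\<lambda>\<omega>. x \<omega> \<bullet> (matrix_inv G *v x \<omega>)) \<in> borel_measurable M"
  proof -
    have "(\<lambda>y. y \<bullet> (matrix_inv G *v y)) \<in> borel_measurable borel"
      by (intro borel_measurable_continuous_onI continuous_intros linear_continuous_on)
        (simp add: linear_conv_bounded_linear[symmetric])
    then show ?thesis by measurable
  qed
  have "1 - \<epsilon> = prob {\<omega> \<in> space M. x \<omega> \<bullet> (matrix_inv S *v x \<omega>) \<le> c}"
    using multivariate_normal_mahalanobis_chi[OF M N] c by simp
  also have "\<dots> \<le> prob {\<omega> \<in> space M. x \<omega> \<bullet> (matrix_inv G *v x \<omega>) \<le> d}"
  proof (rule finite_measure_mono)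
    show "{\<omega> \<in> space M. x \<omega> \<bullet> (matrix_inv S *v x \<omega>) \<le> c}
        \<subseteq> {\<omega> \<in> space M. x \<omega> \<bullet> (matrix_inv G *v x \<omega>) \<le> d}"
    proof safe
      fix \<omega> assume "x \<omega> \<bullet> (matrix_inv S *v x \<omega>) \<le> c"
      then have "d / c * (x \<omega> \<bullet> (matrix_inv S *v x \<omega>)) \<le> d / c * c"
        using c d by (intro mult_left_mono) auto
      moreover have "x \<omega> \<bullet> (matrix_inv G *v x \<omega>) \<le> d / c * (x \<omega> \<bullet> (matrix_inv S *v x \<omega>))"
        using le c d by (intro loewner_le_inverse_quadratic_form S G) (auto simp: c_def)
      ultimately show "x \<omega> \<bullet> (matrix_inv G *v x \<omega>) \<le> d"
        using c by simp
    qed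
    show "{\<omega> \<in> space M. x \<omega> \<bullet> (matrix_inv G *v x \<omega>) \<le> d} \<in> sets M"
      using meas by measurable
  qed
  finally show ?thesis
    unfolding joint_chance_constraint_def .
qed

section \<open>The joint chance constraint\<close>

theorem lemma9:
  fixes A :: "real^'n^'n" and B :: "real^'m^'n" and K :: "real^'n^'m"
    and W X G :: "real^'n^'n" and d \<epsilon> :: real
    and N :: "'a measure" and w :: "nat \<Rightarrow> 'a \<Rightarrow> real^'n"
    and M :: "'b measure" and x :: "'b \<Rightarrow> real^'n"
  assumes "stabilizable A B"
    and "prob_space N" and "white_noise N w W" and "pos_def W"
    and "strictly_stabilizing A B K"
    and "prob_space M"
    and "pos_def G" and "0 < d" and "0 < \<epsilon>" and "\<epsilon> < 1"
    and "symmetric_matrix X" and "stationary_covariance A B K W \<preceq>\<^sub>L X"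
  shows "(stationary_state_wss M x (stationary_covariance A B K W) \<longrightarrow>
            X \<preceq>\<^sub>L (d * \<epsilon> / real CARD('n)) *\<^sub>R G \<longrightarrow>
            joint_chance_constraint M x G d \<epsilon>) \<and>
         ((\<forall>t. multivariate_normal N (w t) 0 W) \<longrightarrow>
            stationary_state_nrm M x (stationary_covariance A B K W) \<longrightarrow>
            X \<preceq>\<^sub>L (d / chi_inv CARD('n) (1 - \<epsilon>)) *\<^sub>R G \<longrightarrow>
            joint_chance_constraint M x G d \<epsilon>)"
proof (intro conjI impI)
  assume x: "stationary_state_wss M x (stationary_covariance A B K W)"
    and X: "X \<preceq>\<^sub>L (d * \<epsilon> / real CARD('n)) *\<^sub>R G"
  show "joint_chance_constraint M x G d \<epsilon>"
    by (rule wss_joint_chance_constraint[OF assms(6-8) x loewner_le_trans[OF assms(12) X]])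
next
  assume x: "stationary_state_nrm M x (stationary_covariance A B K W)"
    and X: "X \<preceq>\<^sub>L (d / chi_inv CARD('n) (1 - \<epsilon>)) *\<^sub>R G"
  show "joint_chance_constraint M x G d \<epsilon>"
    by (rule nrm_joint_chance_constraint[OF assms(6-10) x loewner_le_trans[OF assms(12) X]])
qed

end
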